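(* Let $\mathbb{C}$ be a strongly unital category in which a morphism is a monomorphism if and only if its kernel is $0$. For an object $X$ in $\mathbb{C}$ the following conditions are equivalent: (a) $X$ is abelian; (b) $\langle 1,1\rangle:X\to X\times X$ is a normal monomorphism; (c) $\langle 1,1\rangle:X\to X\times X$ is a Bourn-normal monomorphism.
   Context: In a pointed category, $0$ denotes the zero object and also every zero morphism. A category is unital if it is pointed, finitely complete, and for all objects $X,Y$ the morphisms $\langle 1,0\rangle:X\to X\times Y$ and $\langle 0,1\rangle:Y\to X\times Y$ are jointly strongly epimorphic. It is strongly unital (in the sense of Borceux and Bourn) if it is pointed, finitely complete, and for all objects $X,Y$ and every morphism $h:X\to Y$ the morphisms $\langle 1,h\rangle:X\to X\times Y$ and $\langle 0,1\rangle:Y\to X\times Y$ are jointly strongly epimorphic; every strongly unital category is unital (take $h=0$). An object $X$ is abelian if it admits an internal abelian group structure; in a strongly unital category this is equivalent to $1_X$ Huq-commuting with $1_X$, i.e. to the existence of a morphism $\varphi:X\times X\to X$ with $\varphi\langle 1,0\rangle=1_X=\varphi\langle 0,1\rangle$. A normal monomorphism is a morphism that is the kernel of some morphism. A monomorphism $k:X\to A$ is Bourn-normal if it is the zero class of an internal equivalence relation, i.e. there are an equivalence relation $r_1,r_2:R\to A$ and a morphism $\kappa:X\to R$ such that $\langle r_1,r_2\rangle\kappa=\langle 1,0\rangle k$ and this square is a pullback (of $\langle r_1,r_2\rangle:R\to A\times A$ along $\langle 1,0\rangle:A\to A\times A$). *)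

theory Defs
  imports Main
begin

section \<open>Categories\<close>

record ('o, 'm) precategory =
  Obj :: "'o set"
  Arr :: "'m set"
  Dom :: "'m \<Rightarrow> 'o"
  Cod :: "'m \<Rightarrow> 'o"
  Id :: "'o \<Rightarrow> 'm"
  Comp :: "'m \<Rightarrow> 'm \<Rightarrow> 'm"  (infixl \<open>\<cdot>\<index>\<close> 70)

text \<open>Composition is written in the usual order: \<open>g \<cdot>\<^bsub>C\<^esub> f\<close> is \<open>g\<close> after \<open>f\<close>.
  Nothing is assumed about \<open>Comp\<close> on non-composable pairs.\<close>

definition hom :: "('o, 'm) precategory \<Rightarrow> 'o \<Rightarrow> 'o \<Rightarrow> 'm set" where
  "hom C A B = {f \<in> Arr C. Dom C f = A \<and> Cod C f = B}"

locale category =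
  fixes C :: "('o, 'm) precategory" (structure)
  assumes dom_Obj: "f \<in> Arr C \<Longrightarrow> Dom C f \<in> Obj C"
    and cod_Obj: "f \<in> Arr C \<Longrightarrow> Cod C f \<in> Obj C"
    and id_hom: "A \<in> Obj C \<Longrightarrow> Id C A \<in> hom C A A"
    and comp_hom: "\<lbrakk>f \<in> hom C A B; g \<in> hom C B D\<rbrakk> \<Longrightarrow> g \<cdot> f \<in> hom C A D"
    and comp_assoc: "\<lbrakk>f \<in> hom C A B; g \<in> hom C B D; h \<in> hom C D E\<rbrakk>
      \<Longrightarrow> (h \<cdot> g) \<cdot> f = h \<cdot> (g \<cdot> f)"
    and comp_id_right: "f \<in> hom C A B \<Longrightarrow> f \<cdot> Id C A = f"
    and comp_id_left: "f \<in> hom C A B \<Longrightarrow> Id C B \<cdot> f = f"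

definition is_mono :: "('o, 'm) precategory \<Rightarrow> 'm \<Rightarrow> bool" where
  "is_mono C m \<longleftrightarrow> m \<in> Arr C \<and>
     (\<forall>T. \<forall>u \<in> hom C T (Dom C m). \<forall>v \<in> hom C T (Dom C m).
        m \<cdot>\<^bsub>C\<^esub> u = m \<cdot>\<^bsub>C\<^esub> v \<longrightarrow> u = v)"

section \<open>Finite limits\<close>

definition is_functor ::
  "('i, 'a) precategory \<Rightarrow> ('o, 'm) precategory \<Rightarrow> ('i \<Rightarrow> 'o) \<Rightarrow> ('a \<Rightarrow> 'm) \<Rightarrow> bool" where
  "is_functor J C Fo Fm \<longleftrightarrow>
     (\<forall>j \<in> Obj J. Fo j \<in> Obj C) \<and>
     (\<forall>a \<in> Arr J. Fm a \<in> hom C (Fo (Dom J a)) (Fo (Cod J a))) \<and>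
     (\<forall>j \<in> Obj J. Fm (Id J j) = Id C (Fo j)) \<and>
     (\<forall>a \<in> Arr J. \<forall>b \<in> Arr J. Cod J a = Dom J b \<longrightarrow>
        Fm (b \<cdot>\<^bsub>J\<^esub> a) = Fm b \<cdot>\<^bsub>C\<^esub> Fm a)"

definition is_cone ::
  "('i, 'a) precategory \<Rightarrow> ('o, 'm) precategory \<Rightarrow> ('i \<Rightarrow> 'o) \<Rightarrow> ('a \<Rightarrow> 'm)
    \<Rightarrow> 'o \<Rightarrow> ('i \<Rightarrow> 'm) \<Rightarrow> bool" where
  "is_cone J C Fo Fm L l \<longleftrightarrow>
     L \<in> Obj C \<and>
     (\<forall>j \<in> Obj J. l j \<in> hom C L (Fo j)) \<and>
     (\<forall>a \<in> Arr J. Fm a \<cdot>\<^bsub>C\<^esub> l (Dom J a) = l (Cod J a))"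

definition is_limit ::
  "('i, 'a) precategory \<Rightarrow> ('o, 'm) precategory \<Rightarrow> ('i \<Rightarrow> 'o) \<Rightarrow> ('a \<Rightarrow> 'm)
    \<Rightarrow> 'o \<Rightarrow> ('i \<Rightarrow> 'm) \<Rightarrow> bool" where
  "is_limit J C Fo Fm L l \<longleftrightarrow>
     is_cone J C Fo Fm L l \<and>
     (\<forall>M k. is_cone J C Fo Fm M k \<longrightarrow>
        (\<exists>!u. u \<in> hom C M L \<and> (\<forall>j \<in> Obj J. l j \<cdot>\<^bsub>C\<^esub> u = k j)))"

text \<open>Every finite category is isomorphic to one whose objects and arrows are natural numbers,
  so it is enough to quantify over index categories of this type.\<close>

definition finitely_complete :: "('o, 'm) precategory \<Rightarrow> bool" where
  "finitely_complete C \<longleftrightarrow> category C \<and>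
     (\<forall>(J :: (nat, nat) precategory) Fo Fm.
        category J \<and> finite (Obj J) \<and> finite (Arr J) \<and> is_functor J C Fo Fm \<longrightarrow>
        (\<exists>L l. is_limit J C Fo Fm L l))"

definition is_terminal :: "('o, 'm) precategory \<Rightarrow> 'o \<Rightarrow> bool" where
  "is_terminal C T \<longleftrightarrow> T \<in> Obj C \<and> (\<forall>A \<in> Obj C. \<exists>!f. f \<in> hom C A T)"

definition is_initial :: "('o, 'm) precategory \<Rightarrow> 'o \<Rightarrow> bool" where
  "is_initial C I \<longleftrightarrow> I \<in> Obj C \<and> (\<forall>A \<in> Obj C. \<exists>!f. f \<in> hom C I A)"

definition terminal_obj :: "('o, 'm) precategory \<Rightarrow> 'o" where
  "terminal_obj C = (SOME T. is_terminal C T)"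

definition to_terminal :: "('o, 'm) precategory \<Rightarrow> 'o \<Rightarrow> 'm" where
  "to_terminal C A = (THE f. f \<in> hom C A (terminal_obj C))"

definition is_product ::
  "('o, 'm) precategory \<Rightarrow> 'o \<Rightarrow> 'o \<Rightarrow> 'o \<Rightarrow> 'm \<Rightarrow> 'm \<Rightarrow> bool" where
  "is_product C A B P p q \<longleftrightarrow>
     p \<in> hom C P A \<and> q \<in> hom C P B \<and>
     (\<forall>T. \<forall>f \<in> hom C T A. \<forall>g \<in> hom C T B.
        \<exists>!h. h \<in> hom C T P \<and> p \<cdot>\<^bsub>C\<^esub> h = f \<and> q \<cdot>\<^bsub>C\<^esub> h = g)"

text \<open>As usual, a product of every pair of objects is chosen once and for all; all the notions
  below that mention products are invariant under the choice.\<close>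

definition product_cone :: "('o, 'm) precategory \<Rightarrow> 'o \<Rightarrow> 'o \<Rightarrow> 'o \<times> 'm \<times> 'm" where
  "product_cone C A B = (SOME (P, p, q). is_product C A B P p q)"

definition product :: "('o, 'm) precategory \<Rightarrow> 'o \<Rightarrow> 'o \<Rightarrow> 'o" where
  "product C A B = fst (product_cone C A B)"

definition pr1 :: "('o, 'm) precategory \<Rightarrow> 'o \<Rightarrow> 'o \<Rightarrow> 'm" where
  "pr1 C A B = fst (snd (product_cone C A B))"

definition pr2 :: "('o, 'm) precategory \<Rightarrow> 'o \<Rightarrow> 'o \<Rightarrow> 'm" where
  "pr2 C A B = snd (snd (product_cone C A B))"

definition pair :: "('o, 'm) precategory \<Rightarrow> 'm \<Rightarrow> 'm \<Rightarrow> 'm"  (\<open>\<langle>_,/ _\<rangle>\<index>\<close>) where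
  "\<langle>f, g\<rangle>\<^bsub>C\<^esub> = (THE h. h \<in> hom C (Dom C f) (product C (Cod C f) (Cod C g)) \<and>
     pr1 C (Cod C f) (Cod C g) \<cdot>\<^bsub>C\<^esub> h = f \<and>
     pr2 C (Cod C f) (Cod C g) \<cdot>\<^bsub>C\<^esub> h = g)"

text \<open>\<open>is_pullback C p q f g\<close>: the square \<open>f \<cdot> p = g \<cdot> q\<close> is a pullback.\<close>

definition is_pullback ::
  "('o, 'm) precategory \<Rightarrow> 'm \<Rightarrow> 'm \<Rightarrow> 'm \<Rightarrow> 'm \<Rightarrow> bool" where
  "is_pullback C p q f g \<longleftrightarrow>
     f \<in> Arr C \<and> g \<in> Arr C \<and> Cod C f = Cod C g \<and>
     p \<in> hom C (Dom C p) (Dom C f) \<and> q \<in> hom C (Dom C p) (Dom C g) \<and>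
     f \<cdot>\<^bsub>C\<^esub> p = g \<cdot>\<^bsub>C\<^esub> q \<and>
     (\<forall>T. \<forall>u \<in> hom C T (Dom C f). \<forall>v \<in> hom C T (Dom C g).
        f \<cdot>\<^bsub>C\<^esub> u = g \<cdot>\<^bsub>C\<^esub> v \<longrightarrow>
        (\<exists>!h. h \<in> hom C T (Dom C p) \<and> p \<cdot>\<^bsub>C\<^esub> h = u \<and> q \<cdot>\<^bsub>C\<^esub> h = v))"

section \<open>Pointed categories, kernels and normal monomorphisms\<close>

definition is_zero_obj :: "('o, 'm) precategory \<Rightarrow> 'o \<Rightarrow> bool" where
  "is_zero_obj C Z \<longleftrightarrow> is_initial C Z \<and> is_terminal C Z"

definition pointed :: "('o, 'm) precategory \<Rightarrow> bool" where
  "pointed C \<longleftrightarrow> category C \<and> (\<exists>Z. is_zero_obj C Z)"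

definition zero_mor :: "('o, 'm) precategory \<Rightarrow> 'o \<Rightarrow> 'o \<Rightarrow> 'm" where
  "zero_mor C A B = (THE f. \<exists>Z u v. is_zero_obj C Z \<and> u \<in> hom C A Z \<and> v \<in> hom C Z B \<and>
     f = v \<cdot>\<^bsub>C\<^esub> u)"

definition is_kernel :: "('o, 'm) precategory \<Rightarrow> 'm \<Rightarrow> 'm \<Rightarrow> bool" where
  "is_kernel C k f \<longleftrightarrow>
     f \<in> Arr C \<and> k \<in> Arr C \<and> Cod C k = Dom C f \<and>
     f \<cdot>\<^bsub>C\<^esub> k = zero_mor C (Dom C k) (Cod C f) \<and>
     (\<forall>T. \<forall>u \<in> hom C T (Dom C f). f \<cdot>\<^bsub>C\<^esub> u = zero_mor C T (Cod C f) \<longrightarrow>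
        (\<exists>!h. h \<in> hom C T (Dom C k) \<and> k \<cdot>\<^bsub>C\<^esub> h = u))"

definition has_zero_kernel :: "('o, 'm) precategory \<Rightarrow> 'm \<Rightarrow> bool" where
  "has_zero_kernel C f \<longleftrightarrow> (\<exists>Z. is_zero_obj C Z \<and> is_kernel C (zero_mor C Z (Dom C f)) f)"

definition normal_mono :: "('o, 'm) precategory \<Rightarrow> 'm \<Rightarrow> bool" where
  "normal_mono C k \<longleftrightarrow> (\<exists>f. is_kernel C k f)"

definition equivalence_relation ::
  "('o, 'm) precategory \<Rightarrow> 'o \<Rightarrow> 'o \<Rightarrow> 'm \<Rightarrow> 'm \<Rightarrow> bool" where
  "equivalence_relation C A R r1 r2 \<longleftrightarrow>
     r1 \<in> hom C R A \<and> r2 \<in> hom C R A \<and> is_mono C \<langle>r1, r2\<rangle>\<^bsub>C\<^esub> \<and>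
     (\<exists>e \<in> hom C A R. r1 \<cdot>\<^bsub>C\<^esub> e = Id C A \<and> r2 \<cdot>\<^bsub>C\<^esub> e = Id C A) \<and>
     (\<exists>s \<in> hom C R R. r1 \<cdot>\<^bsub>C\<^esub> s = r2 \<and> r2 \<cdot>\<^bsub>C\<^esub> s = r1) \<and>
     (\<forall>p q. is_pullback C p q r2 r1 \<longrightarrow>
        (\<exists>t \<in> hom C (Dom C p) R.
           r1 \<cdot>\<^bsub>C\<^esub> t = r1 \<cdot>\<^bsub>C\<^esub> p \<and> r2 \<cdot>\<^bsub>C\<^esub> t = r2 \<cdot>\<^bsub>C\<^esub> q))"

definition bourn_normal_mono :: "('o, 'm) precategory \<Rightarrow> 'm \<Rightarrow> bool" where
  "bourn_normal_mono C k \<longleftrightarrow> is_mono C k \<and>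
     (\<exists>R r1 r2 \<kappa>. equivalence_relation C (Cod C k) R r1 r2 \<and> \<kappa> \<in> hom C (Dom C k) R \<and>
        is_pullback C \<kappa> k \<langle>r1, r2\<rangle>\<^bsub>C\<^esub>
          \<langle>Id C (Cod C k), zero_mor C (Cod C k) (Cod C k)\<rangle>\<^bsub>C\<^esub>)"

section \<open>Strongly unital categories\<close>

text \<open>A pair with common codomain is jointly strongly epimorphic if it is jointly epimorphic and
  jointly left orthogonal to every monomorphism.  In the presence of finite limits this amounts
  to saying that every monomorphism through which both factor is invertible.\<close>

definition jointly_epi :: "('o, 'm) precategory \<Rightarrow> 'm \<Rightarrow> 'm \<Rightarrow> bool" where
  "jointly_epi C f g \<longleftrightarrow>
     f \<in> Arr C \<and> g \<in> Arr C \<and> Cod C f = Cod C g \<and>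
     (\<forall>T. \<forall>u \<in> hom C (Cod C f) T. \<forall>v \<in> hom C (Cod C f) T.
        u \<cdot>\<^bsub>C\<^esub> f = v \<cdot>\<^bsub>C\<^esub> f \<and> u \<cdot>\<^bsub>C\<^esub> g = v \<cdot>\<^bsub>C\<^esub> g \<longrightarrow> u = v)"

definition jointly_strongly_epi :: "('o, 'm) precategory \<Rightarrow> 'm \<Rightarrow> 'm \<Rightarrow> bool" where
  "jointly_strongly_epi C f g \<longleftrightarrow> jointly_epi C f g \<and>
     (\<forall>m a b w. is_mono C m \<and> a \<in> hom C (Dom C f) (Dom C m) \<and> b \<in> hom C (Dom C g) (Dom C m) \<and>
        w \<in> hom C (Cod C f) (Cod C m) \<and>
        m \<cdot>\<^bsub>C\<^esub> a = w \<cdot>\<^bsub>C\<^esub> f \<and> m \<cdot>\<^bsub>C\<^esub> b = w \<cdot>\<^bsub>C\<^esub> g \<longrightarrow>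
        (\<exists>d \<in> hom C (Cod C f) (Dom C m).
           d \<cdot>\<^bsub>C\<^esub> f = a \<and> d \<cdot>\<^bsub>C\<^esub> g = b \<and> m \<cdot>\<^bsub>C\<^esub> d = w))"

definition strongly_unital :: "('o, 'm) precategory \<Rightarrow> bool" where
  "strongly_unital C \<longleftrightarrow> pointed C \<and> finitely_complete C \<and>
     (\<forall>X \<in> Obj C. \<forall>Y \<in> Obj C. \<forall>h \<in> hom C X Y.
        jointly_strongly_epi C \<langle>Id C X, h\<rangle>\<^bsub>C\<^esub> \<langle>zero_mor C Y X, Id C Y\<rangle>\<^bsub>C\<^esub>)"

section \<open>Abelian objects\<close>

text \<open>Associativity is expressed on \<open>X \<times> (X \<times> X)\<close>, with projections
  \<open>x\<close>, \<open>y\<close>, \<open>z\<close> to the three factors.\<close>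

definition abelian_group_structure ::
  "('o, 'm) precategory \<Rightarrow> 'o \<Rightarrow> 'm \<Rightarrow> 'm \<Rightarrow> 'm \<Rightarrow> bool" where
  "abelian_group_structure C X m e i \<longleftrightarrow>
     m \<in> hom C (product C X X) X \<and> e \<in> hom C (terminal_obj C) X \<and> i \<in> hom C X X \<and>
     (let x = pr1 C X (product C X X);
          y = pr1 C X X \<cdot>\<^bsub>C\<^esub> pr2 C X (product C X X);
          z = pr2 C X X \<cdot>\<^bsub>C\<^esub> pr2 C X (product C X X)
      in m \<cdot>\<^bsub>C\<^esub> \<langle>m \<cdot>\<^bsub>C\<^esub> \<langle>x, y\<rangle>\<^bsub>C\<^esub>, z\<rangle>\<^bsub>C\<^esub> =
         m \<cdot>\<^bsub>C\<^esub> \<langle>x, m \<cdot>\<^bsub>C\<^esub> \<langle>y, z\<rangle>\<^bsub>C\<^esub>\<rangle>\<^bsub>C\<^esub>) \<and>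
     m \<cdot>\<^bsub>C\<^esub> \<langle>e \<cdot>\<^bsub>C\<^esub> to_terminal C X, Id C X\<rangle>\<^bsub>C\<^esub> = Id C X \<and>
     m \<cdot>\<^bsub>C\<^esub> \<langle>Id C X, e \<cdot>\<^bsub>C\<^esub> to_terminal C X\<rangle>\<^bsub>C\<^esub> = Id C X \<and>
     m \<cdot>\<^bsub>C\<^esub> \<langle>i, Id C X\<rangle>\<^bsub>C\<^esub> = e \<cdot>\<^bsub>C\<^esub> to_terminal C X \<and>
     m \<cdot>\<^bsub>C\<^esub> \<langle>Id C X, i\<rangle>\<^bsub>C\<^esub> = e \<cdot>\<^bsub>C\<^esub> to_terminal C X \<and>
     m \<cdot>\<^bsub>C\<^esub> \<langle>pr2 C X X, pr1 C X X\<rangle>\<^bsub>C\<^esub> = m"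

definition abelian_object :: "('o, 'm) precategory \<Rightarrow> 'o \<Rightarrow> bool" where
  "abelian_object C X \<longleftrightarrow> (\<exists>m e i. abelian_group_structure C X m e i)"

end

theory Submission
  imports Defs
begin

text \<open>Generalized elements make the argument set-like. If the diagonal is the kernel of a morphism,
  it is the zero class of the kernel pair; and if \<open>X\<close> is a group, it is the kernel of subtraction.
  Conversely, let the diagonal be the zero class of an equivalence relation \<open>R\<close> on \<open>X \<times> X\<close>, so
  that \<open>(a, b) R (0, 0)\<close> holds exactly when \<open>a = b\<close>, and consider
  \<open>T = {(a, b, c). (a, b) R (c, 0)}\<close>. The projection \<open>(a, b, c) \<mapsto> (b, c)\<close> has zero kernel on \<open>T\<close>,
  hence is a monomorphism; as \<open>T\<close> contains all \<open>(b, b, 0)\<close> and \<open>(c, 0, c)\<close>, it is invertible by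
  unitality, and \<open>a\<close> becomes a function \<open>\<phi> (b, c)\<close> with \<open>\<phi> (b, 0) = b\<close> and \<open>\<phi> (0, c) = c\<close>.
  Such a \<open>\<phi>\<close> is commutative and associative since the two injections are jointly epic. The shear
  \<open>(b, c) \<mapsto> (b, \<phi> (b, c))\<close> has zero kernel and its image contains all \<open>(b, b)\<close> and \<open>(0, c)\<close>, so it
  is invertible by strong unitality, which provides inverses.\<close>

section \<open>Composition\<close>

context category
begin

lemma hom_iff: "f \<in> hom C A B \<longleftrightarrow> f \<in> Arr C \<and> Dom C f = A \<and> Cod C f = B"
  by (simp add: hom_def)

text \<open>Typing is phrased with \<open>Arr\<close>, \<open>Dom\<close> and \<open>Cod\<close>
  instead of \<open>hom\<close>, so that simp checks composability by rewriting, with no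
  intermediate object to guess. With \<open>assoc\<close>, composites get right-nested normal
  forms.\<close>

lemma comp_simps [simp]:
  assumes "f \<in> Arr C" "g \<in> Arr C" "Dom C g = Cod C f"
  shows "g \<cdot> f \<in> Arr C" "Dom C (g \<cdot> f) = Dom C f" "Cod C (g \<cdot> f) = Cod C g"
  using comp_hom[of f "Dom C f" "Cod C f" g "Cod C g"] assms by (simp_all add: hom_iff)

lemma assoc [simp]:
  assumes "f \<in> Arr C" "g \<in> Arr C" "h \<in> Arr C" "Dom C g = Cod C f" "Dom C h = Cod C g"
  shows "(h \<cdot> g) \<cdot> f = h \<cdot> (g \<cdot> f)"
  using comp_assoc[of f "Dom C f" "Cod C f" g "Cod C g" h "Cod C h"] assms by (simp add: hom_iff)

lemma Id_simps [simp]: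
  assumes "A \<in> Obj C"
  shows "Id C A \<in> Arr C" "Dom C (Id C A) = A" "Cod C (Id C A) = A"
  using id_hom[OF assms] by (simp_all add: hom_iff)

lemma Id_comp [simp]: "f \<in> Arr C \<Longrightarrow> Cod C f = B \<Longrightarrow> Id C B \<cdot> f = f"
  using comp_id_left[of f "Dom C f" B] by (simp add: hom_iff)

lemma comp_Id [simp]: "f \<in> Arr C \<Longrightarrow> Dom C f = A \<Longrightarrow> f \<cdot> Id C A = f"
  using comp_id_right[of f A "Cod C f"] by (simp add: hom_iff)

declare dom_Obj [simp] cod_Obj [simp]

lemma mono_cancel:
  assumes "is_mono C m" "u \<in> Arr C" "v \<in> Arr C" "Cod C u = Dom C m" "Cod C v = Dom C m"
    "Dom C u = Dom C v" "m \<cdot> u = m \<cdot> v"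
  shows "u = v"
  using assms unfolding is_mono_def Ball_def hom_iff by metis

lemma pullbackD:
  assumes "is_pullback C p q f g"
  shows "p \<in> Arr C" "q \<in> Arr C" "f \<in> Arr C" "g \<in> Arr C" "Cod C p = Dom C f" "Cod C q = Dom C g"
    "Dom C q = Dom C p" "Cod C g = Cod C f" "f \<cdot> p = g \<cdot> q"
  using assms unfolding is_pullback_def hom_iff by auto

lemma pullback_lift:
  assumes "is_pullback C p q f g" "u \<in> Arr C" "v \<in> Arr C" "Dom C v = Dom C u"
    "Cod C u = Dom C f" "Cod C v = Dom C g" "f \<cdot> u = g \<cdot> v"
  obtains h where "h \<in> Arr C" "Dom C h = Dom C u" "Cod C h = Dom C p" "p \<cdot> h = u" "q \<cdot> h = v"
proof -
  have "u \<in> hom C (Dom C u) (Dom C f)" "v \<in> hom C (Dom C u) (Dom C g)"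
    using assms by (auto simp: hom_iff)
  then have "\<exists>h. h \<in> hom C (Dom C u) (Dom C p) \<and> p \<cdot> h = u \<and> q \<cdot> h = v"
    using assms(1,7) unfolding is_pullback_def by blast
  then show ?thesis
    using that unfolding hom_iff by blast
qed

text \<open>Joint monicity of the projections: \<open>h\<close> and \<open>k\<close> both factor the
  pair \<open>p \<cdot> k\<close>, \<open>q \<cdot> k\<close>, which commutes because the square
  does.\<close>

lemma pullback_unique:
  assumes pb: "is_pullback C p q f g" and "h \<in> Arr C" "k \<in> Arr C" "Cod C h = Dom C p"
    "Cod C k = Dom C p" "Dom C k = Dom C h" "p \<cdot> h = p \<cdot> k" "q \<cdot> h = q \<cdot> k"
  shows "h = k"
proof -
  note [simp] = pullbackD(1-8)[OF pb] assms(2-)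
  have "f \<cdot> (p \<cdot> k) = (f \<cdot> p) \<cdot> k"
    by simp
  also have "\<dots> = g \<cdot> (q \<cdot> k)"
    unfolding pullbackD(9)[OF pb] by simp
  finally have "\<exists>!l. l \<in> hom C (Dom C h) (Dom C p) \<and> p \<cdot> l = p \<cdot> k \<and> q \<cdot> l = q \<cdot> k"
    using pb unfolding is_pullback_def by (simp add: hom_iff)
  then show ?thesis
    using assms(2-) unfolding hom_iff by metis
qed

end

section \<open>Pullbacks from finite completeness\<close>

text \<open>The objects are \<open>0, 1, 2\<close>, each also standing for its identity; \<open>3 : 0 \<rightarrow> 2\<close> and \<open>4 : 1 \<rightarrow> 2\<close>.\<close>

definition cospan :: "(nat, nat) precategory" where
  "cospan = \<lparr>Obj = {0, 1, 2}, Arr = {0, 1, 2, 3, 4},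
     Dom = (\<lambda>a. if a = 3 then 0 else if a = 4 then 1 else a),
     Cod = (\<lambda>a. if a = 3 \<or> a = 4 then 2 else a),
     Id = (\<lambda>a. a), Comp = (\<lambda>b a. if b < 3 then a else b)\<rparr>"

text \<open>In any composable pair one arrow is an identity, since nothing but an identity ends at
  \<open>0\<close> or \<open>1\<close> or starts at \<open>2\<close>. Hence \<open>Comp\<close> only
  has to select the other arrow.\<close>

lemma category_cospan: "category cospan"
  by unfold_locales (auto simp: cospan_def hom_def split: if_splits)

lemma finitely_complete_pullback:
  assumes fc: "finitely_complete C" and f: "f \<in> Arr C" and g: "g \<in> Arr C"
    and cod: "Cod C g = Cod C f"
  shows "\<exists>p q. is_pullback C p q f g"
proof -
  interpret category C
    using fc by (simp add: finitely_complete_def)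
  define Fo where "Fo j = (if j = 0 then Dom C f else if j = 1 then Dom C g else Cod C f)"
    for j :: nat
  define Fm where "Fm a = (if a = 3 then f else if a = 4 then g else Id C (Fo a))" for a :: nat
  have "is_functor cospan C Fo Fm"
    using f g cod by (auto simp: is_functor_def cospan_def Fo_def Fm_def hom_iff split: if_splits)
  moreover have "finite (Obj cospan)" "finite (Arr cospan)"
    by (simp_all add: cospan_def)
  ultimately obtain L l where lim: "is_limit cospan C Fo Fm L l"
    using fc category_cospan unfolding finitely_complete_def by blast
  \<comment> \<open>The leg at \<open>2\<close> is forced to be the common composite, so cones over
    the cospan are exactly commuting squares.\<close>
  have cone_iff: "is_cone cospan C Fo Fm M k \<longleftrightarrow> M \<in> Obj C \<and> k 0 \<in> hom C M (Dom C f) \<and>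
      k 1 \<in> hom C M (Dom C g) \<and> k 2 \<in> hom C M (Cod C f) \<and>
      f \<cdot>\<^bsub>C\<^esub> k 0 = k 2 \<and> g \<cdot>\<^bsub>C\<^esub> k 1 = k 2" for M k
    unfolding is_cone_def using f g cod
    by (auto simp: cospan_def Fo_def Fm_def hom_iff)
  have l: "L \<in> Obj C" "l 0 \<in> hom C L (Dom C f)" "l 1 \<in> hom C L (Dom C g)"
      "f \<cdot>\<^bsub>C\<^esub> l 0 = l 2" "g \<cdot>\<^bsub>C\<^esub> l 1 = l 2"
    using lim unfolding is_limit_def cone_iff by auto
  have "is_pullback C (l 0) (l 1) f g"
    unfolding is_pullback_def
  proof (intro conjI allI ballI impI)
    fix T u v
    assume u: "u \<in> hom C T (Dom C f)" and v: "v \<in> hom C T (Dom C g)"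
      and eq: "f \<cdot>\<^bsub>C\<^esub> u = g \<cdot>\<^bsub>C\<^esub> v"
    define k where "k j = (if j = 0 then u else if j = 1 then v else f \<cdot>\<^bsub>C\<^esub> u)" for j :: nat
    have "is_cone cospan C Fo Fm T k"
      using u v f unfolding cone_iff by (auto simp: k_def hom_iff simp flip: eq)
    then have "\<exists>!h. h \<in> hom C T L \<and> (\<forall>j \<in> Obj cospan. l j \<cdot>\<^bsub>C\<^esub> h = k j)"
      using lim unfolding is_limit_def by blast
    \<comment> \<open>The condition at \<open>2\<close> follows from the one at \<open>0\<close>, so
      limit factorizations and pullback factorizations agree.\<close>
    moreover have "(\<forall>j \<in> Obj cospan. l j \<cdot>\<^bsub>C\<^esub> h = k j) \<longleftrightarrow> l 0 \<cdot>\<^bsub>C\<^esub> h = u \<and> l 1 \<cdot>\<^bsub>C\<^esub> h = v"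
      if "h \<in> hom C T L" for h
      using that l f by (auto simp: cospan_def k_def hom_iff simp flip: l(4))
    ultimately show "\<exists>!h. h \<in> hom C T (Dom C (l 0)) \<and> l 0 \<cdot>\<^bsub>C\<^esub> h = u \<and> l 1 \<cdot>\<^bsub>C\<^esub> h = v"
      using l(2) by (smt (verit) hom_iff)
  qed (use l f g cod in \<open>auto simp: hom_iff\<close>)
  then show ?thesis
    by blast
qed

section \<open>Pointed finitely complete categories\<close>

locale pointed_complete = category +
  assumes zero_ex: "\<exists>Z. is_zero_obj C Z"
    and fin_complete: "finitely_complete C"
begin

text \<open>This makes the description in \<open>zero_mor\<close> single-valued: a morphism
  \<open>t\<close> between two zero objects carries one factorization to the other, by terminality
  on the left half and initiality on the right half.\<close>

lemma zero_mor_eq: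
  assumes Z: "is_zero_obj C Z" and u: "u \<in> hom C A Z" and v: "v \<in> hom C Z B"
  shows "zero_mor C A B = v \<cdot> u"
  unfolding zero_mor_def
proof (rule the_equality)
  fix f
  assume "\<exists>Z u v. is_zero_obj C Z \<and> u \<in> hom C A Z \<and> v \<in> hom C Z B \<and> f = v \<cdot> u"
  then obtain Z' u' v' where Z': "is_zero_obj C Z'" and u': "u' \<in> hom C A Z'"
    and v': "v' \<in> hom C Z' B" and f: "f = v' \<cdot> u'"
    by blast
  obtain t where t: "t \<in> hom C Z Z'"
    using Z Z' unfolding is_zero_obj_def is_initial_def by blast
  have "t \<cdot> u \<in> hom C A Z'" "v' \<cdot> t \<in> hom C Z B"
    using t u v' by (auto simp: hom_iff)
  moreover have "A \<in> Obj C" "B \<in> Obj C"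
    using u v by (auto simp: hom_iff)
  ultimately have "t \<cdot> u = u'" "v' \<cdot> t = v"
    using u' v Z Z' unfolding is_zero_obj_def is_initial_def is_terminal_def by blast+
  then show "f = v \<cdot> u"
    using f t u v' by (auto simp: hom_iff)
qed (use assms in blast)

lemma zero_factor:
  assumes "A \<in> Obj C" "B \<in> Obj C"
  obtains Z u v where "is_zero_obj C Z" "u \<in> hom C A Z" "v \<in> hom C Z B"
  using zero_ex assms unfolding is_zero_obj_def is_initial_def is_terminal_def by blast

lemma zero_simps [simp]:
  assumes "A \<in> Obj C" "B \<in> Obj C"
  shows "zero_mor C A B \<in> Arr C" "Dom C (zero_mor C A B) = A" "Cod C (zero_mor C A B) = B"
proof -
  obtain Z u v where "is_zero_obj C Z" "u \<in> hom C A Z" "v \<in> hom C Z B"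
    using zero_factor[OF assms] .
  then show "zero_mor C A B \<in> Arr C" "Dom C (zero_mor C A B) = A" "Cod C (zero_mor C A B) = B"
    using zero_mor_eq by (auto simp: hom_iff)
qed

lemma comp_zero [simp]:
  assumes "f \<in> Arr C" "A \<in> Obj C" "Dom C f = B"
  shows "f \<cdot> zero_mor C A B = zero_mor C A (Cod C f)"
proof -
  have "B \<in> Obj C"
    using assms by auto
  then obtain Z u v where Z: "is_zero_obj C Z" "u \<in> hom C A Z" "v \<in> hom C Z B"
    using zero_factor[OF assms(2)] by blast
  then have "zero_mor C A (Cod C f) = (f \<cdot> v) \<cdot> u"
    using assms by (intro zero_mor_eq) (auto simp: hom_iff)
  then show ?thesis
    using Z assms zero_mor_eq[OF Z] by (auto simp: hom_iff)
qed

lemma zero_comp [simp]: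
  assumes "f \<in> Arr C" "B \<in> Obj C" "Cod C f = A"
  shows "zero_mor C A B \<cdot> f = zero_mor C (Dom C f) B"
proof -
  have "A \<in> Obj C"
    using assms by auto
  then obtain Z u v where Z: "is_zero_obj C Z" "u \<in> hom C A Z" "v \<in> hom C Z B"
    using zero_factor[OF _ assms(2)] by blast
  then have "zero_mor C (Dom C f) B = v \<cdot> (u \<cdot> f)"
    using assms by (intro zero_mor_eq) (auto simp: hom_iff)
  then show ?thesis
    using Z assms zero_mor_eq[OF Z] by (auto simp: hom_iff)
qed

lemma into_zero_obj:
  assumes "is_zero_obj C Z" "f \<in> Arr C" "Cod C f = Z"
  shows "f = zero_mor C (Dom C f) Z"
  using assms zero_simps[of "Dom C f" Z] cod_Obj[of f] dom_Obj[of f]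
  unfolding is_zero_obj_def is_terminal_def hom_iff by metis

section \<open>Binary products and pairing\<close>

lemma product_exists:
  assumes A: "A \<in> Obj C" and B: "B \<in> Obj C"
  shows "\<exists>P p q. is_product C A B P p q"
proof -
  obtain Z where Z: "is_zero_obj C Z"
    using zero_ex by blast
  then have ZO: "Z \<in> Obj C"
    by (simp add: is_zero_obj_def is_initial_def)
  \<comment> \<open>Over a zero object every square commutes, so a pullback there is a
    product.\<close>
  obtain p q where pb: "is_pullback C p q (zero_mor C A Z) (zero_mor C B Z)"
    using finitely_complete_pullback[OF fin_complete, of "zero_mor C A Z" "zero_mor C B Z"] A B ZO
    by auto
  have "is_product C A B (Dom C p) p q"
    using pb A B ZO unfolding is_pullback_def is_product_def by (auto simp: hom_iff)
  then show ?thesis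
    by blast
qed

lemma product_is_product:
  assumes "A \<in> Obj C" "B \<in> Obj C"
  shows "is_product C A B (product C A B) (pr1 C A B) (pr2 C A B)"
proof -
  have "\<exists>x. case x of (P, p, q) \<Rightarrow> is_product C A B P p q"
    using product_exists[OF assms] by auto
  then have "case product_cone C A B of (P, p, q) \<Rightarrow> is_product C A B P p q"
    unfolding product_cone_def by (rule someI_ex)
  then show ?thesis
    by (simp add: product_def pr1_def pr2_def split: prod.splits)
qed

lemma pr_simps [simp]:
  assumes "A \<in> Obj C" "B \<in> Obj C"
  shows "pr1 C A B \<in> Arr C" "Dom C (pr1 C A B) = product C A B" "Cod C (pr1 C A B) = A"
    "pr2 C A B \<in> Arr C" "Dom C (pr2 C A B) = product C A B" "Cod C (pr2 C A B) = B"
  using product_is_product[OF assms] by (auto simp: is_product_def hom_iff)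

lemma product_Obj [simp]:
  assumes "A \<in> Obj C" "B \<in> Obj C"
  shows "product C A B \<in> Obj C"
  using dom_Obj[of "pr1 C A B"] assms by simp

lemma pair_char:
  assumes "f \<in> Arr C" "g \<in> Arr C" "Dom C f = Dom C g"
  shows "\<langle>f, g\<rangle> \<in> hom C (Dom C f) (product C (Cod C f) (Cod C g)) \<and>
     pr1 C (Cod C f) (Cod C g) \<cdot> \<langle>f, g\<rangle> = f \<and> pr2 C (Cod C f) (Cod C g) \<cdot> \<langle>f, g\<rangle> = g"
  unfolding pair_def
  by (rule theI') (use product_is_product[of "Cod C f" "Cod C g"] assms in
      \<open>simp add: is_product_def hom_iff\<close>)

lemma pair_simps [simp]:
  assumes "f \<in> Arr C" "g \<in> Arr C" "Dom C f = Dom C g"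
  shows "\<langle>f, g\<rangle> \<in> Arr C" "Dom C \<langle>f, g\<rangle> = Dom C g" "Cod C \<langle>f, g\<rangle> = product C (Cod C f) (Cod C g)"
  using pair_char[OF assms] assms by (auto simp: hom_iff)

lemma pr_pair [simp]:
  assumes "f \<in> Arr C" "g \<in> Arr C" "Dom C f = Dom C g" "Cod C f = A" "Cod C g = B"
  shows "pr1 C A B \<cdot> \<langle>f, g\<rangle> = f" "pr2 C A B \<cdot> \<langle>f, g\<rangle> = g"
  using pair_char[OF assms(1-3)] assms by auto

lemma pr_eqI:
  assumes "h \<in> Arr C" "k \<in> Arr C" "Dom C h = Dom C k" "Cod C h = product C A B"
    "Cod C k = product C A B" "A \<in> Obj C" "B \<in> Obj C"
    "pr1 C A B \<cdot> h = pr1 C A B \<cdot> k" "pr2 C A B \<cdot> h = pr2 C A B \<cdot> k"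
  shows "h = k"
proof -
  have "pr1 C A B \<cdot> k \<in> hom C (Dom C k) A" "pr2 C A B \<cdot> k \<in> hom C (Dom C k) B"
    using assms by (auto simp: hom_iff)
  then have "\<exists>!l. l \<in> hom C (Dom C k) (product C A B) \<and> pr1 C A B \<cdot> l = pr1 C A B \<cdot> k \<and>
      pr2 C A B \<cdot> l = pr2 C A B \<cdot> k"
    using product_is_product[OF assms(6,7)] unfolding is_product_def by blast
  then show ?thesis
    using assms unfolding hom_iff by metis
qed

lemma pair_comp [simp]:
  assumes "f \<in> Arr C" "g \<in> Arr C" "Dom C f = Dom C g" "u \<in> Arr C" "Cod C u = Dom C g"
  shows "\<langle>f, g\<rangle> \<cdot> u = \<langle>f \<cdot> u, g \<cdot> u\<rangle>"
proof -
  have *: "pr1 C (Cod C f) (Cod C g) \<cdot> (\<langle>f, g\<rangle> \<cdot> u) = f \<cdot> u"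
    "pr2 C (Cod C f) (Cod C g) \<cdot> (\<langle>f, g\<rangle> \<cdot> u) = g \<cdot> u"
    using assms by (simp_all flip: assoc)
  show ?thesis
    by (rule pr_eqI[where A = "Cod C f" and B = "Cod C g"]) (simp_all add: assms *)
qed

lemma pair_eq_iff [simp]:
  assumes "f \<in> Arr C" "g \<in> Arr C" "Dom C f = Dom C g" "f' \<in> Arr C" "g' \<in> Arr C"
    "Dom C f' = Dom C g'" "Cod C f = Cod C f'" "Cod C g = Cod C g'"
  shows "\<langle>f, g\<rangle> = \<langle>f', g'\<rangle> \<longleftrightarrow> f = f' \<and> g = g'"
  using pr_pair[OF assms(1-3,7,8)] pr_pair[OF assms(4-6) refl refl] by metis

lemma pair_pr:
  assumes "u \<in> Arr C" "Cod C u = product C A B" "A \<in> Obj C" "B \<in> Obj C"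
  shows "\<langle>pr1 C A B \<cdot> u, pr2 C A B \<cdot> u\<rangle> = u"
  by (rule pr_eqI[where A = A and B = B]) (use assms in auto)

lemma pair_pr_Id [simp]:
  assumes "A \<in> Obj C" "B \<in> Obj C"
  shows "\<langle>pr1 C A B, pr2 C A B\<rangle> = Id C (product C A B)"
  by (rule pr_eqI[where A = A and B = B]) (use assms in auto)

lemma pair_zero [simp]:
  assumes "T \<in> Obj C" "A \<in> Obj C" "B \<in> Obj C"
  shows "\<langle>zero_mor C T A, zero_mor C T B\<rangle> = zero_mor C T (product C A B)"
  by (rule pr_eqI[where A = A and B = B]) (use assms in auto)

section \<open>Kernels, normal and Bourn-normal monomorphisms\<close>

lemma zero_kernelI:
  assumes "f \<in> hom C A B"
    and ker: "\<And>T u. T \<in> Obj C \<Longrightarrow> u \<in> Arr C \<Longrightarrow> Dom C u = T \<Longrightarrow> Cod C u = A \<Longrightarrow>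
      f \<cdot> u = zero_mor C T B \<Longrightarrow> u = zero_mor C T A"
  shows "has_zero_kernel C f"
proof -
  have f: "f \<in> Arr C" "Dom C f = A" "Cod C f = B" "A \<in> Obj C" "B \<in> Obj C"
    using assms(1) by (auto simp: hom_iff)
  obtain Z where Z: "is_zero_obj C Z"
    using zero_ex by blast
  then have ZO: "Z \<in> Obj C"
    by (simp add: is_zero_obj_def is_initial_def)
  have "is_kernel C (zero_mor C Z A) f"
    unfolding is_kernel_def
  proof (intro conjI allI ballI impI)
    fix T u
    assume "u \<in> hom C T (Dom C f)" and fu: "f \<cdot> u = zero_mor C T (Cod C f)"
    then have u: "u \<in> Arr C" "Dom C u = T" "Cod C u = A"
      using f by (auto simp: hom_iff)
    have T: "T \<in> Obj C"
      using dom_Obj[OF u(1)] u(2) by simp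
    have u0: "u = zero_mor C T A"
      using ker[OF T u] fu f by simp
    \<comment> \<open>Once \<open>u\<close> is zero it factors through \<open>Z\<close>, and
      uniquely so because only one morphism from \<open>T\<close> to \<open>Z\<close>
      exists.\<close>
    show "\<exists>!h. h \<in> hom C T (Dom C (zero_mor C Z A)) \<and> zero_mor C Z A \<cdot> h = u"
    proof (rule ex1I[of _ "zero_mor C T Z"])
      fix h
      assume "h \<in> hom C T (Dom C (zero_mor C Z A)) \<and> zero_mor C Z A \<cdot> h = u"
      then show "h = zero_mor C T Z"
        using into_zero_obj[OF Z, of h] f ZO by (auto simp: hom_iff)
    qed (use T f u0 ZO in \<open>simp add: hom_iff\<close>)
  qed (use f ZO in simp_all)
  then show ?thesis
    using Z f(2) unfolding has_zero_kernel_def by blast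
qed

text \<open>If \<open>k \<cdot> u = k \<cdot> v\<close>, then \<open>u\<close> and \<open>v\<close>
  factor the same morphism, which \<open>f\<close> kills, through the kernel.\<close>

lemma normal_mono_is_mono:
  assumes "normal_mono C k"
  shows "is_mono C k"
proof -
  obtain f where f: "is_kernel C k f"
    using assms unfolding normal_mono_def by blast
  then have [simp]: "f \<in> Arr C" "k \<in> Arr C" "Cod C k = Dom C f"
    and fk: "f \<cdot> k = zero_mor C (Dom C k) (Cod C f)"
    unfolding is_kernel_def by auto
  show ?thesis
    unfolding is_mono_def
  proof (intro conjI allI ballI impI)
    fix T u v
    assume u: "u \<in> hom C T (Dom C k)" and v: "v \<in> hom C T (Dom C k)" and eq: "k \<cdot> u = k \<cdot> v"
    from u have [simp]: "u \<in> Arr C" "Dom C u = T" "Cod C u = Dom C k"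
      by (auto simp: hom_iff)
    have "f \<cdot> (k \<cdot> u) = (f \<cdot> k) \<cdot> u"
      by simp
    also have "\<dots> = zero_mor C T (Cod C f)"
      unfolding fk by simp
    finally have "\<exists>!h. h \<in> hom C T (Dom C k) \<and> k \<cdot> h = k \<cdot> u"
      using f unfolding is_kernel_def by (simp add: hom_iff)
    then show "u = v"
      using u v eq by metis
  qed simp
qed

text \<open>Generalized elements of the kernel pair are the pairs with equal image under
  \<open>f\<close>, so reflexivity, symmetry and transitivity are inherited from equality.\<close>

lemma kernel_pair_equivalence:
  assumes f: "f \<in> Arr C" and pb: "is_pullback C p q f f"
  shows "equivalence_relation C (Dom C f) (Dom C p) p q"
proof -
  note pq = pullbackD[OF pb]
  note [simp] = pq(1-8)
  have lift: "\<exists>h. h \<in> hom C (Dom C u) (Dom C p) \<and> p \<cdot> h = u \<and> q \<cdot> h = v"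
    if "u \<in> Arr C" "v \<in> Arr C" "Dom C v = Dom C u" "Cod C u = Dom C f" "Cod C v = Dom C f"
      "f \<cdot> u = f \<cdot> v" for u v
    using pullback_lift[OF pb that] unfolding hom_iff by metis
  have "is_mono C \<langle>p, q\<rangle>"
    unfolding is_mono_def by (auto simp: hom_iff intro: pullback_unique[OF pb])
  moreover have "\<exists>e \<in> hom C (Dom C f) (Dom C p). p \<cdot> e = Id C (Dom C f) \<and> q \<cdot> e = Id C (Dom C f)"
    using lift[of "Id C (Dom C f)" "Id C (Dom C f)"] by auto
  moreover have "\<exists>s \<in> hom C (Dom C p) (Dom C p). p \<cdot> s = q \<and> q \<cdot> s = p"
    using lift[of q p] pq(9) by auto
  \<comment> \<open>Transitivity: the outer elements \<open>p \<cdot> p'\<close> and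
    \<open>q \<cdot> q'\<close> share the middle element \<open>q \<cdot> p' = p \<cdot> q'\<close>,
    and all three have the same image under \<open>f\<close>.\<close>
  moreover have "\<exists>t \<in> hom C (Dom C p') (Dom C p). p \<cdot> t = p \<cdot> p' \<and> q \<cdot> t = q \<cdot> q'"
    if pb': "is_pullback C p' q' q p" for p' q'
  proof -
    note pq' = pullbackD[OF pb']
    note [simp] = pq'(1-8)
    have "f \<cdot> (p \<cdot> p') = (f \<cdot> p) \<cdot> p'"
      by simp
    also have "\<dots> = f \<cdot> (q \<cdot> p')"
      unfolding pq(9) by simp
    also have "\<dots> = (f \<cdot> p) \<cdot> q'"
      unfolding pq'(9) by simp
    also have "\<dots> = f \<cdot> (q \<cdot> q')"
      unfolding pq(9) by simp
    finally show ?thesis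
      using lift[of "p \<cdot> p'" "q \<cdot> q'"] by auto
  qed
  ultimately show ?thesis
    unfolding equivalence_relation_def by (simp add: hom_iff)
qed

text \<open>An element x is related to 0 by the kernel pair of \<open>f\<close> exactly when f x =
  0, that is, when x lies in the kernel.\<close>

lemma normal_imp_bourn_normal:
  assumes "normal_mono C k"
  shows "bourn_normal_mono C k"
proof -
  obtain f where ker: "is_kernel C k f"
    using assms unfolding normal_mono_def by blast
  then have [simp]: "f \<in> Arr C" "k \<in> Arr C" "Cod C k = Dom C f"
    and fk: "f \<cdot> k = zero_mor C (Dom C k) (Cod C f)"
    unfolding is_kernel_def by auto
  obtain p q where pb: "is_pullback C p q f f"
    using finitely_complete_pullback[OF fin_complete, of f f] by auto
  note pq = pullbackD[OF pb]
  note [simp] = pq(1,2,5-7)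
  \<comment> \<open>\<open>\<kappa>\<close> sends x to the pair (k x, 0), which the kernel pair
    contains because \<open>f\<close> kills \<open>k\<close>.\<close>
  obtain \<kappa> where [simp]: "\<kappa> \<in> Arr C" "Dom C \<kappa> = Dom C k" "Cod C \<kappa> = Dom C p"
    and \<kappa>: "p \<cdot> \<kappa> = k" "q \<cdot> \<kappa> = zero_mor C (Dom C k) (Dom C f)"
    by (rule pullback_lift[OF pb, of k "zero_mor C (Dom C k) (Dom C f)"]) (simp_all add: fk)
  have "is_pullback C \<kappa> k \<langle>p, q\<rangle> \<langle>Id C (Dom C f), zero_mor C (Dom C f) (Dom C f)\<rangle>"
    unfolding is_pullback_def
  proof (intro conjI allI ballI impI)
    fix T u v
    assume "u \<in> hom C T (Dom C \<langle>p, q\<rangle>)"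
      "v \<in> hom C T (Dom C \<langle>Id C (Dom C f), zero_mor C (Dom C f) (Dom C f)\<rangle>)"
      and eq: "\<langle>p, q\<rangle> \<cdot> u = \<langle>Id C (Dom C f), zero_mor C (Dom C f) (Dom C f)\<rangle> \<cdot> v"
    then have u: "u \<in> Arr C" "Dom C u = T" "Cod C u = Dom C p"
      and v: "v \<in> Arr C" "Dom C v = T" "Cod C v = Dom C f"
      by (auto simp: hom_iff)
    note [simp] = u v
    have T: "T \<in> Obj C"
      using dom_Obj[OF u(1)] by simp
    from eq T have pu: "p \<cdot> u = v" and qu: "q \<cdot> u = zero_mor C T (Dom C f)"
      by auto
    have "f \<cdot> v = (f \<cdot> p) \<cdot> u"
      by (simp add: pu)
    also have "\<dots> = zero_mor C T (Cod C f)"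
      unfolding pq(9) using T by (simp add: qu)
    finally have ex1: "\<exists>!h. h \<in> hom C T (Dom C k) \<and> k \<cdot> h = v"
      using ker unfolding is_kernel_def by (simp add: hom_iff)
    \<comment> \<open>A factorization through \<open>k\<close> is automatically one through
      \<open>\<kappa>\<close>, since \<open>p\<close> and \<open>q\<close> are jointly
      monic.\<close>
    have "\<kappa> \<cdot> h = u" if h: "h \<in> hom C T (Dom C k)" "k \<cdot> h = v" for h
    proof (rule pullback_unique[OF pb])
      have "p \<cdot> (\<kappa> \<cdot> h) = (p \<cdot> \<kappa>) \<cdot> h" "q \<cdot> (\<kappa> \<cdot> h) = (q \<cdot> \<kappa>) \<cdot> h"
        using h by (simp_all add: hom_iff)
      then show "p \<cdot> (\<kappa> \<cdot> h) = p \<cdot> u" "q \<cdot> (\<kappa> \<cdot> h) = q \<cdot> u"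
        unfolding \<kappa> using h pu qu by (auto simp: hom_iff)
    qed (use h in \<open>auto simp: hom_iff\<close>)
    then show "\<exists>!h. h \<in> hom C T (Dom C \<kappa>) \<and> \<kappa> \<cdot> h = u \<and> k \<cdot> h = v"
      using ex1 by (metis \<open>Dom C \<kappa> = Dom C k\<close>)
  qed (use \<kappa> in \<open>simp_all add: hom_iff\<close>)
  then show ?thesis
    using normal_mono_is_mono[OF assms] kernel_pair_equivalence[OF _ pb]
    unfolding bourn_normal_mono_def
    by (intro conjI exI[of _ "Dom C p"] exI[of _ p] exI[of _ q] exI[of _ \<kappa>]) (auto simp: hom_iff)
qed

section \<open>Abelian objects\<close>

lemma terminal_obj_terminal: "is_terminal C (terminal_obj C)"
  unfolding terminal_obj_def by (rule someI_ex) (use zero_ex in \<open>auto simp: is_zero_obj_def\<close>)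

lemma terminal_obj_Obj [simp]: "terminal_obj C \<in> Obj C"
  using terminal_obj_terminal by (simp add: is_terminal_def)

lemma to_terminal_hom: "A \<in> Obj C \<Longrightarrow> to_terminal C A \<in> hom C A (terminal_obj C)"
  unfolding to_terminal_def
  by (rule theI') (use terminal_obj_terminal in \<open>simp add: is_terminal_def\<close>)

text \<open>The constant map at a unit element is zero, because \<open>to_terminal\<close> is itself
  a zero morphism. The group laws can thus be read with zero as neutral element.\<close>

lemma comp_to_terminal:
  assumes A: "A \<in> Obj C" and e: "e \<in> hom C (terminal_obj C) B"
  shows "e \<cdot> to_terminal C A = zero_mor C A B"
proof -
  have "zero_mor C A (terminal_obj C) \<in> hom C A (terminal_obj C)"
    using A by (simp add: hom_iff)
  then have "to_terminal C A = zero_mor C A (terminal_obj C)"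
    using A to_terminal_hom[OF A] terminal_obj_terminal unfolding is_terminal_def by blast
  then show ?thesis
    using A e by (simp add: hom_iff)
qed

text \<open>The law of the structure concerns the universal triple of projections; composing with
  \<open>\<langle>a, \<langle>b, c\<rangle>\<rangle>\<close> specializes it.\<close>

lemma group_associative:
  assumes "abelian_group_structure C X m e i" "X \<in> Obj C"
    "a \<in> hom C T X" "b \<in> hom C T X" "c \<in> hom C T X"
  shows "m \<cdot> \<langle>m \<cdot> \<langle>a, b\<rangle>, c\<rangle> = m \<cdot> \<langle>a, m \<cdot> \<langle>b, c\<rangle>\<rangle>"
proof -
  let ?x = "pr1 C X (product C X X)"
  let ?y = "pr1 C X X \<cdot> pr2 C X (product C X X)"
  let ?z = "pr2 C X X \<cdot> pr2 C X (product C X X)"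
  have "m \<cdot> \<langle>m \<cdot> \<langle>?x, ?y\<rangle>, ?z\<rangle> = m \<cdot> \<langle>?x, m \<cdot> \<langle>?y, ?z\<rangle>\<rangle>" and m: "m \<in> hom C (product C X X) X"
    using assms(1) unfolding abelian_group_structure_def Let_def by blast+
  then have "(m \<cdot> \<langle>m \<cdot> \<langle>?x, ?y\<rangle>, ?z\<rangle>) \<cdot> \<langle>a, \<langle>b, c\<rangle>\<rangle> = (m \<cdot> \<langle>?x, m \<cdot> \<langle>?y, ?z\<rangle>\<rangle>) \<cdot> \<langle>a, \<langle>b, c\<rangle>\<rangle>"
    by simp
  then show ?thesis
    using assms(2-) m by (simp add: hom_iff)
qed

lemma abelian_imp_normal_diagonal:
  assumes X [simp]: "X \<in> Obj C" and "abelian_object C X"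
  shows "normal_mono C \<langle>Id C X, Id C X\<rangle>"
proof -
  obtain m e i where grp: "abelian_group_structure C X m e i"
    using assms unfolding abelian_object_def by blast
  then have "m \<in> hom C (product C X X) X" and e: "e \<in> hom C (terminal_obj C) X" and "i \<in> hom C X X"
    unfolding abelian_group_structure_def by auto
  then have [simp]: "m \<in> Arr C" "Dom C m = product C X X" "Cod C m = X"
    "i \<in> Arr C" "Dom C i = X" "Cod C i = X"
    by (auto simp: hom_iff)
  note et = comp_to_terminal[OF X e]
  have laws: "m \<cdot> \<langle>zero_mor C X X, Id C X\<rangle> = Id C X" "m \<cdot> \<langle>Id C X, zero_mor C X X\<rangle> = Id C X"
    "m \<cdot> \<langle>i, Id C X\<rangle> = zero_mor C X X" "m \<cdot> \<langle>Id C X, i\<rangle> = zero_mor C X X"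
    using grp unfolding abelian_group_structure_def et by auto
  \<comment> \<open>\<open>?d\<close> is subtraction, (a, b) \<mapsto> a + (-b).\<close>
  let ?d = "m \<cdot> \<langle>pr1 C X X, i \<cdot> pr2 C X X\<rangle>"
  have "is_kernel C \<langle>Id C X, Id C X\<rangle> ?d"
    unfolding is_kernel_def
  proof (intro conjI allI ballI impI)
    fix T u
    assume "u \<in> hom C T (Dom C ?d)" and eq: "?d \<cdot> u = zero_mor C T (Cod C ?d)"
    then have u: "u \<in> Arr C" "Dom C u = T" "Cod C u = product C X X"
      by (auto simp: hom_iff)
    note [simp] = u
    have [simp]: "T \<in> Obj C"
      using dom_Obj[OF u(1)] by simp
    define a where "a = pr1 C X X \<cdot> u"
    define b where "b = pr2 C X X \<cdot> u"
    have [simp]: "a \<in> Arr C" "Dom C a = T" "Cod C a = X" "b \<in> Arr C" "Dom C b = T" "Cod C b = X"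
      by (simp_all add: a_def b_def)
    have u_eq: "u = \<langle>a, b\<rangle>"
      unfolding a_def b_def by (simp add: pair_pr)
    \<comment> \<open>If a - b = 0, then a = a + (-b + b) = (a - b) + b = b.\<close>
    have "m \<cdot> \<langle>a, i \<cdot> b\<rangle> = zero_mor C T X"
      using eq by (simp add: u_eq)
    moreover have "m \<cdot> \<langle>m \<cdot> \<langle>a, i \<cdot> b\<rangle>, b\<rangle> = m \<cdot> \<langle>a, m \<cdot> \<langle>i \<cdot> b, b\<rangle>\<rangle>"
      by (rule group_associative[OF grp X, where T = T]) (simp_all add: hom_iff)
    moreover have "m \<cdot> \<langle>i \<cdot> b, b\<rangle> = zero_mor C T X" "m \<cdot> \<langle>zero_mor C T X, b\<rangle> = b"
      "m \<cdot> \<langle>a, zero_mor C T X\<rangle> = a"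
      using arg_cong[OF laws(3), of "\<lambda>f. f \<cdot> b"] arg_cong[OF laws(1), of "\<lambda>f. f \<cdot> b"]
        arg_cong[OF laws(2), of "\<lambda>f. f \<cdot> a"] by simp_all
    ultimately have "a = b"
      by simp
    then show "\<exists>!h. h \<in> hom C T (Dom C \<langle>Id C X, Id C X\<rangle>) \<and> \<langle>Id C X, Id C X\<rangle> \<cdot> h = u"
      by (intro ex1I[of _ a]) (auto simp: hom_iff u_eq)
  qed (simp_all add: laws)
  then show ?thesis
    unfolding normal_mono_def by blast
qed

end

section \<open>Strongly unital categories\<close>

locale strongly_unital_category = pointed_complete +
  assumes str_unital: "strongly_unital C"
begin

lemma graph_strongly_epi:
  assumes "X \<in> Obj C" "Y \<in> Obj C" "h \<in> hom C X Y"
  shows "jointly_strongly_epi C \<langle>Id C X, h\<rangle> \<langle>zero_mor C Y X, Id C Y\<rangle>"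
  using str_unital assms unfolding strongly_unital_def by blast

lemma injections_jointly_epi:
  assumes [simp]: "X \<in> Obj C" "Y \<in> Obj C"
    and "u \<in> hom C (product C X Y) T" "v \<in> hom C (product C X Y) T"
    and "u \<cdot> \<langle>Id C X, zero_mor C X Y\<rangle> = v \<cdot> \<langle>Id C X, zero_mor C X Y\<rangle>"
      "u \<cdot> \<langle>zero_mor C Y X, Id C Y\<rangle> = v \<cdot> \<langle>zero_mor C Y X, Id C Y\<rangle>"
  shows "u = v"
  using graph_strongly_epi[of X Y "zero_mor C X Y"] assms(3-)
  by (auto simp: jointly_strongly_epi_def jointly_epi_def hom_iff)

text \<open>Orthogonality against the identity of the product yields a section of \<open>m\<close>.
  The case \<open>h = 0\<close> will produce the multiplication, the case \<open>h = 1\<close> the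
  inverses.\<close>

lemma mono_section:
  assumes [simp]: "X \<in> Obj C" "Y \<in> Obj C" and h: "h \<in> hom C X Y"
    and m: "is_mono C m" "Cod C m = product C X Y"
    and a: "a \<in> hom C X (Dom C m)" "m \<cdot> a = \<langle>Id C X, h\<rangle>"
    and b: "b \<in> hom C Y (Dom C m)" "m \<cdot> b = \<langle>zero_mor C Y X, Id C Y\<rangle>"
  obtains d where "d \<in> hom C (product C X Y) (Dom C m)" "m \<cdot> d = Id C (product C X Y)"
    "d \<cdot> \<langle>Id C X, h\<rangle> = a" "d \<cdot> \<langle>zero_mor C Y X, Id C Y\<rangle> = b"
proof -
  let ?f = "\<langle>Id C X, h\<rangle>" and ?g = "\<langle>zero_mor C Y X, Id C Y\<rangle>"
  have [simp]: "h \<in> Arr C" "Dom C h = X" "Cod C h = Y"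
    using h by (auto simp: hom_iff)
  have lift: "\<forall>m a b w. is_mono C m \<and> a \<in> hom C (Dom C ?f) (Dom C m) \<and>
      b \<in> hom C (Dom C ?g) (Dom C m) \<and> w \<in> hom C (Cod C ?f) (Cod C m) \<and>
      m \<cdot> a = w \<cdot> ?f \<and> m \<cdot> b = w \<cdot> ?g \<longrightarrow>
      (\<exists>d \<in> hom C (Cod C ?f) (Dom C m). d \<cdot> ?f = a \<and> d \<cdot> ?g = b \<and> m \<cdot> d = w)"
    using graph_strongly_epi[OF _ _ h] by (simp add: jointly_strongly_epi_def)
  have "\<exists>d \<in> hom C (Cod C ?f) (Dom C m).
      d \<cdot> ?f = a \<and> d \<cdot> ?g = b \<and> m \<cdot> d = Id C (product C X Y)"
    by (rule lift[rule_format]) (use m a b in \<open>simp add: hom_iff\<close>)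
  then show ?thesis
    using that by auto
qed

end

section \<open>Objects whose identity Huq-commutes with itself\<close>

locale unital_multiplication = strongly_unital_category +
  fixes X and \<phi>
  assumes X [simp]: "X \<in> Obj C"
    and \<phi>: "\<phi> \<in> hom C (product C X X) X"
    and \<phi>_unit: "\<phi> \<cdot> \<langle>Id C X, zero_mor C X X\<rangle> = Id C X" "\<phi> \<cdot> \<langle>zero_mor C X X, Id C X\<rangle> = Id C X"
begin

lemma \<phi>_simps [simp]: "\<phi> \<in> Arr C" "Dom C \<phi> = product C X X" "Cod C \<phi> = X"
  using \<phi> by (auto simp: hom_iff)

lemma \<phi>_zero_right [simp]:
  assumes "a \<in> Arr C" "Cod C a = X" "Dom C a = T"
  shows "\<phi> \<cdot> \<langle>a, zero_mor C T X\<rangle> = a"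
  using arg_cong[OF \<phi>_unit(1), of "\<lambda>f. f \<cdot> a"] assms by simp

lemma \<phi>_zero_left [simp]:
  assumes "a \<in> Arr C" "Cod C a = X" "Dom C a = T"
  shows "\<phi> \<cdot> \<langle>zero_mor C T X, a\<rangle> = a"
  using arg_cong[OF \<phi>_unit(2), of "\<lambda>f. f \<cdot> a"] assms by simp

text \<open>Both sides restrict to the identity along each of the two injections.\<close>

lemma \<phi>_commutative: "\<phi> \<cdot> \<langle>pr2 C X X, pr1 C X X\<rangle> = \<phi>"
  by (rule injections_jointly_epi[of X X _ X]) (simp_all add: hom_iff)

text \<open>On the product of X with X \<times> X, both sides restrict to the identity where y = z =
  0 and to \<open>\<phi>\<close> where x = 0.\<close>

lemma \<phi>_associative:
  fixes x y z
  defines "x \<equiv> pr1 C X (product C X X)"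
    and "y \<equiv> pr1 C X X \<cdot> pr2 C X (product C X X)"
    and "z \<equiv> pr2 C X X \<cdot> pr2 C X (product C X X)"
  shows "\<phi> \<cdot> \<langle>\<phi> \<cdot> \<langle>x, y\<rangle>, z\<rangle> = \<phi> \<cdot> \<langle>x, \<phi> \<cdot> \<langle>y, z\<rangle>\<rangle>"
  unfolding x_def y_def z_def
  by (rule injections_jointly_epi[of X "product C X X" _ X]) (simp_all add: hom_iff)

lemma right_inverse:
  assumes mono: "\<And>f. f \<in> Arr C \<Longrightarrow> has_zero_kernel C f \<Longrightarrow> is_mono C f"
  obtains i where "i \<in> hom C X X" "\<phi> \<cdot> \<langle>Id C X, i\<rangle> = zero_mor C X X"
proof -
  \<comment> \<open>The shear (b, c) \<mapsto> (b, b + c), with \<open>\<phi>\<close> written as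
    addition.\<close>
  let ?m = "\<langle>pr1 C X X, \<phi>\<rangle>"
  have "has_zero_kernel C ?m"
  proof (rule zero_kernelI[of _ "product C X X" "product C X X"])
    fix T u
    assume [simp]: "T \<in> Obj C" "u \<in> Arr C" "Dom C u = T" "Cod C u = product C X X"
      and eq: "?m \<cdot> u = zero_mor C T (product C X X)"
    define b where "b = pr1 C X X \<cdot> u"
    define c where "c = pr2 C X X \<cdot> u"
    have [simp]: "b \<in> Arr C" "Dom C b = T" "Cod C b = X" "c \<in> Arr C" "Dom C c = T" "Cod C c = X"
      by (simp_all add: b_def c_def)
    have u_eq: "u = \<langle>b, c\<rangle>"
      unfolding b_def c_def by (simp add: pair_pr)
    have "\<langle>b, \<phi> \<cdot> \<langle>b, c\<rangle>\<rangle> = \<langle>zero_mor C T X, zero_mor C T X\<rangle>"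
      using eq by (simp add: u_eq)
    \<comment> \<open>\<open>pair_zero\<close> must be off here, or it would merge the two zero
      components before they can be compared.\<close>
    then have b0: "b = zero_mor C T X" and "\<phi> \<cdot> \<langle>b, c\<rangle> = zero_mor C T X"
      by (auto simp del: pair_zero)
    then have "c = zero_mor C T X"
      using \<phi>_zero_left[of c T] by simp
    then show "u = zero_mor C T (product C X X)"
      using b0 by (simp add: u_eq)
  qed (simp add: hom_iff)
  then have "is_mono C ?m"
    by (simp add: mono)
  \<comment> \<open>The shear maps (x, 0) to (x, x) and fixes (0, x), so it contains the graph of
    \<open>h = 1\<close> and the second injection.\<close>
  then obtain d where "d \<in> hom C (product C X X) (Dom C ?m)" and d: "?m \<cdot> d = Id C (product C X X)"
    by (rule mono_section[of X X "Id C X" ?m "\<langle>Id C X, zero_mor C X X\<rangle>"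
          "\<langle>zero_mor C X X, Id C X\<rangle>", rotated 3]) (simp_all add: hom_iff)
  then have [simp]: "d \<in> Arr C" "Dom C d = product C X X" "Cod C d = product C X X"
    by (auto simp: hom_iff)
  have "\<langle>pr1 C X X \<cdot> d, \<phi> \<cdot> d\<rangle> = \<langle>pr1 C X X, pr2 C X X\<rangle>"
    using d by simp
  then have d1: "pr1 C X X \<cdot> d = pr1 C X X" and d2: "\<phi> \<cdot> d = pr2 C X X"
    by (simp_all del: pair_pr_Id)
  \<comment> \<open>The section takes (x, 0) to some (x, y) with x + y = 0; the inverse is this
    y.\<close>
  let ?j = "\<langle>Id C X, zero_mor C X X\<rangle>"
  have "pr1 C X X \<cdot> (d \<cdot> ?j) = Id C X"
    using arg_cong[OF d1, of "\<lambda>f. f \<cdot> ?j"] by simp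
  then have "\<langle>Id C X, pr2 C X X \<cdot> (d \<cdot> ?j)\<rangle> = d \<cdot> ?j"
    using pair_pr[of "d \<cdot> ?j" X X] by simp
  moreover have "\<phi> \<cdot> (d \<cdot> ?j) = zero_mor C X X"
    using arg_cong[OF d2, of "\<lambda>f. f \<cdot> ?j"] by simp
  ultimately show ?thesis
    by (intro that[of "pr2 C X X \<cdot> (d \<cdot> ?j)"]) (simp_all add: hom_iff)
qed

lemma abelian:
  assumes mono: "\<And>f. f \<in> Arr C \<Longrightarrow> has_zero_kernel C f \<Longrightarrow> is_mono C f"
  shows "abelian_object C X"
proof -
  obtain i where "i \<in> hom C X X" and inv: "\<phi> \<cdot> \<langle>Id C X, i\<rangle> = zero_mor C X X"
    using right_inverse[OF mono] .
  then have [simp]: "i \<in> Arr C" "Dom C i = X" "Cod C i = X"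
    by (auto simp: hom_iff)
  let ?e = "zero_mor C (terminal_obj C) X"
  have e: "?e \<cdot> to_terminal C X = zero_mor C X X"
    by (rule comp_to_terminal) (simp_all add: hom_iff)
  \<comment> \<open>Commutativity turns the right inverse into a left one.\<close>
  have "\<phi> \<cdot> \<langle>i, Id C X\<rangle> = zero_mor C X X"
    using arg_cong[OF \<phi>_commutative, of "\<lambda>f. f \<cdot> \<langle>Id C X, i\<rangle>"] inv by simp
  then have "abelian_group_structure C X \<phi> ?e i"
    unfolding abelian_group_structure_def Let_def e
    using \<phi> inv \<phi>_commutative \<phi>_associative by (simp add: hom_iff)
  then show ?thesis
    unfolding abelian_object_def by blast
qed

end

section \<open>From a Bourn-normal diagonal to a group structure\<close>

context strongly_unital_category
begin

text \<open>The model is an abelian group with (a, b) R (c, d) iff a - b = c - d. There (a, b) R (c,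
  0) means a = b + c, so \<open>T\<close> is the graph of the addition to be recovered.\<close>

lemma bourn_normal_diagonal_imp_abelian:
  assumes mono: "\<And>f. f \<in> Arr C \<Longrightarrow> has_zero_kernel C f \<Longrightarrow> is_mono C f"
    and X [simp]: "X \<in> Obj C"
    and bn: "bourn_normal_mono C \<langle>Id C X, Id C X\<rangle>"
  shows "abelian_object C X"
proof -
  let ?XX = "product C X X"
  obtain R r1 r2 \<kappa> where eqv: "equivalence_relation C ?XX R r1 r2"
    and \<kappa>: "\<kappa> \<in> hom C X R"
    and zc: "is_pullback C \<kappa> \<langle>Id C X, Id C X\<rangle> \<langle>r1, r2\<rangle> \<langle>Id C ?XX, zero_mor C ?XX ?XX\<rangle>"
    using bn unfolding bourn_normal_mono_def by auto
  obtain e where r: "r1 \<in> hom C R ?XX" "r2 \<in> hom C R ?XX" and rmono: "is_mono C \<langle>r1, r2\<rangle>"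
    and e: "e \<in> hom C ?XX R" and refl: "r1 \<cdot> e = Id C ?XX" "r2 \<cdot> e = Id C ?XX"
    using eqv unfolding equivalence_relation_def by blast
  from r e \<kappa> have [simp]: "r1 \<in> Arr C" "r2 \<in> Arr C" "Dom C r1 = R" "Dom C r2 = R"
    "Cod C r1 = ?XX" "Cod C r2 = ?XX" "e \<in> Arr C" "Dom C e = ?XX" "Cod C e = R"
    "\<kappa> \<in> Arr C" "Dom C \<kappa> = X" "Cod C \<kappa> = R"
    by (auto simp: hom_iff)
  have [simp]: "R \<in> Obj C"
    using cod_Obj[of e] by simp
  have "\<langle>r1 \<cdot> \<kappa>, r2 \<cdot> \<kappa>\<rangle> = \<langle>\<langle>Id C X, Id C X\<rangle>, zero_mor C X ?XX\<rangle>"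
    using pullbackD(9)[OF zc] by simp
  then have r\<kappa>: "r1 \<cdot> \<kappa> = \<langle>Id C X, Id C X\<rangle>" "r2 \<cdot> \<kappa> = zero_mor C X ?XX"
    by simp_all
  let ?W = "product C X ?XX"
  let ?a = "pr1 C X ?XX"
  let ?b = "pr1 C X X \<cdot> pr2 C X ?XX"
  let ?c = "pr2 C X X \<cdot> pr2 C X ?XX"
  \<comment> \<open>\<open>?w\<close> is (a, b, c) \<mapsto> ((a, b), (c, 0)); pulling back the
    relation along it carves out \<open>T\<close>, with inclusion \<open>t\<close>.\<close>
  let ?w = "\<langle>\<langle>?a, ?b\<rangle>, \<langle>?c, zero_mor C ?W X\<rangle>\<rangle>"
  obtain t v where pb: "is_pullback C t v ?w \<langle>r1, r2\<rangle>"
    using finitely_complete_pullback[OF fin_complete, of ?w "\<langle>r1, r2\<rangle>"] by auto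
  note tv = pullbackD[OF pb]
  define T where "T = Dom C t"
  have [simp]: "t \<in> Arr C" "v \<in> Arr C" "Dom C t = T" "Dom C v = T" "Cod C t = ?W" "Cod C v = R"
    using tv by (auto simp: T_def)
  have [simp]: "T \<in> Obj C"
    using dom_Obj[of t] by simp
  have tvr: "\<langle>\<langle>?a \<cdot> t, ?b \<cdot> t\<rangle>, \<langle>?c \<cdot> t, zero_mor C T X\<rangle>\<rangle> = \<langle>r1, r2\<rangle> \<cdot> v"
    using tv(9) by simp

  let ?m = "pr2 C X ?XX \<cdot> t"
  have "has_zero_kernel C ?m"
  proof (rule zero_kernelI[of _ T ?XX])
    fix S u
    assume [simp]: "S \<in> Obj C" "u \<in> Arr C" "Dom C u = S" "Cod C u = T"
      and eq: "?m \<cdot> u = zero_mor C S ?XX"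
    have tu2: "pr2 C X ?XX \<cdot> (t \<cdot> u) = zero_mor C S ?XX"
      using eq by simp
    \<comment> \<open>With b = c = 0 membership in \<open>T\<close> says (a, 0) R (0, 0). The zero
      class being the diagonal, a = 0.\<close>
    let ?f = "?a \<cdot> (t \<cdot> u)"
    have "\<langle>r1, r2\<rangle> \<cdot> (v \<cdot> u) = \<langle>r1, r2\<rangle> \<cdot> v \<cdot> u"
      by (rule assoc[symmetric]) simp_all
    also have "\<dots> = \<langle>\<langle>?f, zero_mor C S X\<rangle>, zero_mor C S ?XX\<rangle>"
      unfolding tvr[symmetric] by (simp add: tu2)
    also have "\<dots> = \<langle>Id C ?XX, zero_mor C ?XX ?XX\<rangle> \<cdot> \<langle>?f, zero_mor C S X\<rangle>"
      by simp
    finally have class0: "\<langle>r1, r2\<rangle> \<cdot> (v \<cdot> u) =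
        \<langle>Id C ?XX, zero_mor C ?XX ?XX\<rangle> \<cdot> \<langle>?f, zero_mor C S X\<rangle>" .
    obtain h where [simp]: "h \<in> Arr C" "Dom C h = S" "Cod C h = X"
      and "\<langle>Id C X, Id C X\<rangle> \<cdot> h = \<langle>?f, zero_mor C S X\<rangle>"
      by (rule pullback_lift[OF zc _ _ _ _ _ class0]) simp_all
    then have "?f = zero_mor C S X"
      by auto
    then have tu: "t \<cdot> u = zero_mor C S ?W"
      by (intro pr_eqI[where A = X and B = ?XX and h = "t \<cdot> u"]) (simp_all add: tu2)
    \<comment> \<open>The other pullback component vanishes too, by cancelling the mono
      \<open>\<langle>r1, r2\<rangle>\<close>.\<close>
    have "\<langle>r1, r2\<rangle> \<cdot> (v \<cdot> u) = \<langle>r1, r2\<rangle> \<cdot> v \<cdot> u"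
      by (rule assoc[symmetric]) simp_all
    also have "\<dots> = \<langle>r1, r2\<rangle> \<cdot> zero_mor C S R"
      unfolding tvr[symmetric] by (simp add: tu)
    finally have vu: "v \<cdot> u = zero_mor C S R"
      by (intro mono_cancel[OF rmono, of "v \<cdot> u"]) simp_all
    show "u = zero_mor C S T"
      by (rule pullback_unique[OF pb]) (simp_all add: tu vu)
  qed (simp add: hom_iff)
  then have m: "is_mono C ?m"
    by (simp add: mono)

  \<comment> \<open>\<open>\<alpha>\<close> is b \<mapsto> (b, b, 0); \<open>\<kappa>\<close>
    witnesses (b, b) R (0, 0).\<close>
  obtain \<alpha> where [simp]: "\<alpha> \<in> Arr C" "Dom C \<alpha> = X" "Cod C \<alpha> = T"
    and \<alpha>: "t \<cdot> \<alpha> = \<langle>Id C X, \<langle>Id C X, zero_mor C X X\<rangle>\<rangle>"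
    by (rule pullback_lift[OF pb, of "\<langle>Id C X, \<langle>Id C X, zero_mor C X X\<rangle>\<rangle>" \<kappa>]) (simp_all add: r\<kappa>)
  let ?j = "\<langle>Id C X, zero_mor C X X\<rangle>"
  have re: "r1 \<cdot> (e \<cdot> ?j) = ?j" "r2 \<cdot> (e \<cdot> ?j) = ?j"
    using arg_cong[OF refl(1), of "\<lambda>f. f \<cdot> ?j"] arg_cong[OF refl(2), of "\<lambda>f. f \<cdot> ?j"] by simp_all
  \<comment> \<open>\<open>\<beta>\<close> is c \<mapsto> (c, 0, c); reflexivity witnesses (c, 0) R
    (c, 0).\<close>
  obtain \<beta> where [simp]: "\<beta> \<in> Arr C" "Dom C \<beta> = X" "Cod C \<beta> = T"
    and \<beta>: "t \<cdot> \<beta> = \<langle>Id C X, \<langle>zero_mor C X X, Id C X\<rangle>\<rangle>"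
    by (rule pullback_lift[OF pb, of "\<langle>Id C X, \<langle>zero_mor C X X, Id C X\<rangle>\<rangle>" "e \<cdot> ?j"])
      (simp_all add: re del: pair_zero)
  obtain d where "d \<in> hom C ?XX T" and d: "d \<cdot> ?j = \<alpha>" "d \<cdot> \<langle>zero_mor C X X, Id C X\<rangle> = \<beta>"
    by (rule mono_section[of X X "zero_mor C X X" ?m \<alpha> \<beta>]) (simp_all add: hom_iff m \<alpha> \<beta>)
  then have [simp]: "d \<in> Arr C" "Dom C d = ?XX" "Cod C d = T"
    by (auto simp: hom_iff)
  \<comment> \<open>The operation is the first coordinate of the section \<open>d\<close>. Its unit
    laws hold because \<open>\<alpha>\<close> and \<open>\<beta>\<close> both have the identity as
    first coordinate.\<close>
  interpret unital_multiplication C X "?a \<cdot> (t \<cdot> d)"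
    by unfold_locales (simp_all add: hom_iff d \<alpha> \<beta>)
  show ?thesis
    using abelian[OF mono] .
qed

end

theorem corollary3p15:
  fixes C :: "('o, 'm) precategory" and X :: 'o
  assumes "strongly_unital C"
    and "\<And>f. f \<in> Arr C \<Longrightarrow> is_mono C f \<longleftrightarrow> has_zero_kernel C f"
    and "X \<in> Obj C"
  shows "(abelian_object C X \<longleftrightarrow> normal_mono C \<langle>Id C X, Id C X\<rangle>\<^bsub>C\<^esub>) \<and>
    (normal_mono C \<langle>Id C X, Id C X\<rangle>\<^bsub>C\<^esub> \<longleftrightarrow> bourn_normal_mono C \<langle>Id C X, Id C X\<rangle>\<^bsub>C\<^esub>)"
proof -
  interpret category C
    using assms(1) by (simp add: strongly_unital_def pointed_def)
  interpret strongly_unital_category C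
    using assms(1) by unfold_locales (auto simp: strongly_unital_def pointed_def)
  show ?thesis
    using abelian_imp_normal_diagonal normal_imp_bourn_normal bourn_normal_diagonal_imp_abelian
      assms(2,3) by blast
qed

end
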